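(* If $L\subseteq\{0,1\}^*$ is a finite 0-1-symmetric language, then $\mathcal{G}_L$ does not contain all graphs.
   Context: All graphs are finite, simple, undirected, with nonempty vertex sets, and graph classes are considered up to isomorphism. For $w\in\{0,1\}^*$ let $\widetilde{w}$ be obtained from $w$ by exchanging the letters 0 and 1; a language $L\subseteq\{0,1\}^*$ is 0-1-symmetric if $L=\{\widetilde w : w\in L\}$. For an alphabet $V$ and distinct $u,v\in V$, $h_{u,v}:V^*\to\{0,1\}^*$ is the monoid morphism with $u\mapsto 0$, $v\mapsto 1$ and $x\mapsto\lambda$ (empty word) for all other letters $x$. For a 0-1-symmetric $L$ and a nonempty word $w$ whose set of occurring letters is $V$, $G(L,w)$ is the graph with vertex set $V$ in which distinct $u,v$ are adjacent iff $h_{u,v}(w)\in L$. A graph is $L$-representable if it is isomorphic to some $G(L,w)$, and $\mathcal{G}_L$ denotes the class of all $L$-representable graphs. *)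

theory Defs
  imports Main
begin

section \<open>Finite simple undirected graphs\<close>

record 'a ugraph =
  verts :: "'a set"
  edges :: "'a set set"

definition simple_graph :: "'a ugraph \<Rightarrow> bool" where
  "simple_graph G \<longleftrightarrow> finite (verts G) \<and> verts G \<noteq> {} \<and>
     (\<forall>e \<in> edges G. e \<subseteq> verts G \<and> card e = 2)"

definition isomorphic :: "'a ugraph \<Rightarrow> 'b ugraph \<Rightarrow> bool" where
  "isomorphic G H \<longleftrightarrow> (\<exists>f. bij_betw f (verts G) (verts H) \<and>
     (\<forall>u \<in> verts G. \<forall>v \<in> verts G. {u, v} \<in> edges G \<longleftrightarrow> {f u, f v} \<in> edges H))"

section \<open>Binary words\<close>

text \<open>The letters 0 and 1 are encoded as \<^const>\<open>False\<close> and \<^const>\<open>True\<close>.\<close>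

type_synonym bin_word = "bool list"

definition swap01 :: "bin_word \<Rightarrow> bin_word" where
  "swap01 w = map Not w"

definition symmetric01 :: "bin_word set \<Rightarrow> bool" where
  "symmetric01 L \<longleftrightarrow> L = {swap01 w | w. w \<in> L}"

definition h :: "'a \<Rightarrow> 'a \<Rightarrow> 'a list \<Rightarrow> bin_word" where
  "h u v w = concat (map (\<lambda>x. if x = u then [False] else if x = v then [True] else []) w)"

section \<open>Representable graphs\<close>

text \<open>
  The edge relation does not depend on the order of \<open>u\<close> and \<open>v\<close> when \<open>L\<close> is 0-1-symmetric,
  which is the only case in which this graph is meant to be used.
\<close>

definition word_graph :: "bin_word set \<Rightarrow> 'a list \<Rightarrow> 'a ugraph" where
  "word_graph L w = \<lparr>verts = set w,
     edges = {{u, v} | u v. u \<in> set w \<and> v \<in> set w \<and> u \<noteq> v \<and> h u v w \<in> L}\<rparr>"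

text \<open>
  Words are taken over the natural numbers: a word has only finitely many letters, and renaming
  them injectively changes the graph only up to isomorphism; see \<open>representableI\<close> below.
\<close>

definition representable :: "bin_word set \<Rightarrow> 'a ugraph \<Rightarrow> bool" where
  "representable L G \<longleftrightarrow> (\<exists>w :: nat list. w \<noteq> [] \<and> isomorphic G (word_graph L w))"

text \<open>
  Graph classes are considered up to isomorphism, so they are represented by sets of graphs on
  natural numbers; by \<open>ex_isomorphic_nat_graph\<close> below no isomorphism type is lost.
\<close>

definition all_graphs :: "nat ugraph set" where
  "all_graphs = {G. simple_graph G}"

definition graph_class :: "bin_word set \<Rightarrow> nat ugraph set" where
  "graph_class L = {G. simple_graph G \<and> representable L G}"

section \<open>Adequacy of the encodings\<close>

lemma simple_graph_word_graph:
  assumes "w \<noteq> []"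
  shows "simple_graph (word_graph L w)"
  using assms by (auto simp: simple_graph_def word_graph_def)

lemma swap01_h:
  assumes "u \<noteq> v"
  shows "swap01 (h u v w) = h v u w"
  using assms by (induction w) (auto simp: h_def swap01_def)

lemma adjacent_word_graph_iff:
  assumes "symmetric01 L" "u \<in> set w" "v \<in> set w" "u \<noteq> v"
  shows "{u, v} \<in> edges (word_graph L w) \<longleftrightarrow> h u v w \<in> L"
proof -
  have "h u v w \<in> L" if "h v u w \<in> L"
  proof -
    have "swap01 (h v u w) \<in> {swap01 w | w. w \<in> L}" using that by blast
    then show ?thesis using assms(1,4) swap01_h[of v u w] unfolding symmetric01_def by metis
  qed
  then show ?thesis
    using assms(2-4) by (auto simp: word_graph_def doubleton_eq_iff)
qed

lemma h_map_inj:
  assumes "inj_on f (set w \<union> {u, v})"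
  shows "h (f u) (f v) (map f w) = h u v w"
  using assms
proof (induction w)
  case Nil
  show ?case by (simp add: h_def)
next
  case (Cons x w)
  have "f x = f u \<longleftrightarrow> x = u" "f x = f v \<longleftrightarrow> x = v"
    using inj_on_eq_iff[OF Cons.prems, of x u] inj_on_eq_iff[OF Cons.prems, of x v] by simp_all
  moreover have "h (f u) (f v) (map f w) = h u v w"
    by (rule Cons.IH, rule inj_on_subset[OF Cons.prems]) auto
  ultimately show ?case
    by (simp add: h_def)
qed

lemma isomorphic_word_graph_map:
  assumes "symmetric01 L" "inj_on f (set w)"
  shows "isomorphic (word_graph L w) (word_graph L (map f w))"
  unfolding isomorphic_def
proof (intro exI[of _ f] conjI ballI)
  show "bij_betw f (verts (word_graph L w)) (verts (word_graph L (map f w)))"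
    using assms(2) by (simp add: word_graph_def bij_betw_def)
next
  fix u v assume "u \<in> verts (word_graph L w)" "v \<in> verts (word_graph L w)"
  then have uv: "u \<in> set w" "v \<in> set w" by (simp_all add: word_graph_def)
  show "{u, v} \<in> edges (word_graph L w) \<longleftrightarrow> {f u, f v} \<in> edges (word_graph L (map f w))"
  proof (cases "u = v")
    case True
    then show ?thesis by (auto simp: word_graph_def)
  next
    case False
    then have "f u \<noteq> f v" using uv assms(2) by (simp add: inj_on_eq_iff)
    moreover have "h (f u) (f v) (map f w) = h u v w"
      using h_map_inj[of f w u v] uv assms(2) by (simp add: insert_absorb)
    ultimately show ?thesis
      using adjacent_word_graph_iff[OF assms(1) uv False]
        adjacent_word_graph_iff[OF assms(1), of "f u" "map f w" "f v"] uv
      by simp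
  qed
qed

lemma isomorphic_trans:
  assumes "isomorphic G H" "isomorphic H K"
  shows "isomorphic G K"
proof -
  obtain f where f: "bij_betw f (verts G) (verts H)"
    "\<forall>u \<in> verts G. \<forall>v \<in> verts G. {u, v} \<in> edges G \<longleftrightarrow> {f u, f v} \<in> edges H"
    using assms(1) unfolding isomorphic_def by blast
  obtain g where g: "bij_betw g (verts H) (verts K)"
    "\<forall>u \<in> verts H. \<forall>v \<in> verts H. {u, v} \<in> edges H \<longleftrightarrow> {g u, g v} \<in> edges K"
    using assms(2) unfolding isomorphic_def by blast
  have "{u, v} \<in> edges G \<longleftrightarrow> {(g \<circ> f) u, (g \<circ> f) v} \<in> edges K"
    if "u \<in> verts G" "v \<in> verts G" for u v
    using that f(2) g(2) bij_betwE[OF f(1)] by simp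
  then show ?thesis
    unfolding isomorphic_def using bij_betw_trans[OF f(1) g(1)] by blast
qed

lemma representableI:
  fixes w :: "'b list"
  assumes "symmetric01 L" "w \<noteq> []" "isomorphic G (word_graph L w)"
  shows "representable L G"
proof -
  obtain f :: "'b \<Rightarrow> nat" where "inj_on f (set w)"
    using finite_imp_inj_to_nat_seg[of "set w"] by auto
  then have "isomorphic G (word_graph L (map f w))"
    using assms isomorphic_trans isomorphic_word_graph_map by blast
  then show ?thesis
    using assms(2) unfolding representable_def by (intro exI[of _ "map f w"]) simp
qed

lemma ex_isomorphic_nat_graph:
  fixes G :: "'a ugraph"
  assumes "simple_graph G"
  shows "\<exists>H \<in> all_graphs. isomorphic G H"
proof -
  obtain f :: "'a \<Rightarrow> nat" where f: "inj_on f (verts G)"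
    using assms finite_imp_inj_to_nat_seg[of "verts G"] by (auto simp: simple_graph_def)
  define H where "H = \<lparr>verts = f ` verts G, edges = (`) f ` edges G\<rparr>"
  have "card (f ` e) = 2" if "e \<in> edges G" for e
    using assms that card_image[OF inj_on_subset[OF f, of e]] by (simp add: simple_graph_def)
  then have "simple_graph H"
    using assms by (auto simp: simple_graph_def H_def)
  moreover have "{u, v} \<in> edges G \<longleftrightarrow> {f u, f v} \<in> edges H"
    if "u \<in> verts G" "v \<in> verts G" for u v
  proof -
    have "{u, v} = e" if "e \<in> edges G" "f ` {u, v} = f ` e" for e
      using that \<open>u \<in> verts G\<close> \<open>v \<in> verts G\<close> assms inj_on_image_eq_iff[OF f, of "{u, v}" e]
      by (auto simp: simple_graph_def)
    then show ?thesis by (auto simp: H_def image_iff)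
  qed
  moreover have "bij_betw f (verts G) (verts H)"
    using f by (simp add: H_def bij_betw_def)
  ultimately show ?thesis
    unfolding isomorphic_def all_graphs_def by blast
qed

end

theory Submission
  imports Defs
begin

text \<open>
  Let \<open>k\<close> bound the lengths of the words in \<open>L\<close>. A letter occurring more than \<open>k\<close> times in \<open>w\<close> is an
  isolated vertex. So if no vertex is isolated, a set \<open>A\<close> of \<open>m\<close> letters occupies at most \<open>m * k\<close>
  positions of \<open>w\<close>, and the adjacencies of any other letter to \<open>A\<close> depend only on how its at most \<open>k\<close>
  occurrences are interleaved with these positions. This leaves only polynomially many (in \<open>m\<close>)
  neighbourhoods within \<open>A\<close>, whereas a graph can realise all \<open>2 ^ m - 1\<close> nonempty ones.
\<close>

text \<open>Writing \<open>None\<close> for \<open>v\<close> makes the words of different letters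
  \<open>v\<close> comparable: equal interleavings give equal neighbourhoods within
  \<open>A\<close>.\<close>

definition interleaving :: "'a set \<Rightarrow> 'a \<Rightarrow> 'a list \<Rightarrow> 'a option list" where
  "interleaving A v w =
     map (\<lambda>x. if x = v then None else Some x) (filter (\<lambda>x. x \<in> A \<or> x = v) w)"

lemma h_interleaving:
  assumes "u \<in> A" "v \<notin> A"
  shows "h (Some u) None (interleaving A v w) = h u v w"
  using assms by (induction w) (auto simp: h_def interleaving_def)

lemma interleaving_in_shuffles:
  assumes "v \<notin> A"
  shows "interleaving A v w \<in>
    shuffles (map Some (filter (\<lambda>x. x \<in> A) w)) (replicate (count_list w v) None)"
  using assms
  by (induction w) (auto simp: interleaving_def intro: Cons_in_shuffles_leftI Cons_in_shuffles_rightI)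

text \<open>An edge puts \<open>h u v w\<close> into \<open>L\<close>, so a bound on the lengths in
  \<open>L\<close> bounds the occurrences of both endpoints.\<close>

lemma count_list_le_length_h:
  assumes "u \<noteq> v"
  shows "count_list w u \<le> length (h u v w)" "count_list w v \<le> length (h u v w)"
  using assms by (induction w) (auto simp: h_def)

lemma length_filter_mem_le:
  assumes "finite A" "\<And>u. u \<in> A \<Longrightarrow> count_list w u \<le> k"
  shows "length (filter (\<lambda>x. x \<in> A) w) \<le> card A * k"
proof -
  let ?v = "filter (\<lambda>x. x \<in> A) w"
  have *: "count_list ?v u \<le> k" if "u \<in> A" for u
  proof -
    have "count_list ?v u \<le> count_list w u" by (induction w) auto
    then show ?thesis using assms(2)[OF that] by simp
  qed
  have "length ?v = (\<Sum>u\<in>A. count_list ?v u)"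
    using sum_count_set[of ?v A, OF _ assms(1)] by force
  also have "\<dots> \<le> card A * k"
    using sum_mono[of A "count_list ?v" "\<lambda>_. k"] * by simp
  finally show ?thesis .
qed

text \<open>The map from \<open>v\<close> to its neighbourhood within \<open>A\<close> factors
  through its interleaving, a shuffle of one fixed word with at most \<open>k\<close> copies of
  \<open>None\<close>.\<close>

lemma card_neighbourhoods_le:
  assumes "finite A" "A \<inter> B = {}" "\<And>u. u \<in> A \<union> B \<Longrightarrow> count_list w u \<le> k"
  shows "card ((\<lambda>v. {u \<in> A. h u v w \<in> L}) ` B) \<le> Suc k * (card A * k + k) ^ k"
proof -
  define a where "a = map Some (filter (\<lambda>x. x \<in> A) w)"
  define I where "I = (\<Union>j\<le>k. shuffles a (replicate j None))"
  have len: "length a \<le> card A * k"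
    unfolding a_def using length_filter_mem_le[of A w k] assms by simp
  have card_shuffles: "card (shuffles a (replicate j None)) \<le> (card A * k + k) ^ k" if "j \<le> k" for j
  \<comment> \<open>Raising the exponent from \<open>j\<close> to \<open>k\<close> below needs a
    base of at least 1, which fails for \<open>k = 0\<close>.\<close>
  proof (cases "k = 0")
    case True
    then show ?thesis using that by simp
  next
    case False
    have "card (shuffles a (replicate j None)) = (length a + j) choose length a"
      by (subst card_disjoint_shuffles) (auto simp: a_def)
    \<comment> \<open>By symmetry the exponent of the power bound becomes \<open>j\<close>, which is
      at most \<open>k\<close> whatever the size of \<open>A\<close>.\<close>
    also have "\<dots> = (length a + j) choose j"
      by (subst binomial_symmetric) auto
    also have "\<dots> \<le> (length a + j) ^ j"
      by (rule binomial_le_pow) simp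
    also have "\<dots> \<le> (card A * k + k) ^ j"
      using len that by (intro power_mono) auto
    also have "\<dots> \<le> (card A * k + k) ^ k"
      using False that by (intro power_increasing) auto
    finally show ?thesis .
  qed
  have finI: "finite I" unfolding I_def by simp
  have "(\<lambda>v. {u \<in> A. h u v w \<in> L}) ` B \<subseteq> (\<lambda>s. {u \<in> A. h (Some u) None s \<in> L}) ` I"
  proof (rule image_subsetI)
    fix v assume v: "v \<in> B"
    then have nv: "v \<notin> A" using assms(2) by auto
    have "interleaving A v w \<in> I"
      using interleaving_in_shuffles[OF nv, of w] assms(3)[of v] v unfolding I_def a_def by blast
    moreover have "{u \<in> A. h u v w \<in> L} = {u \<in> A. h (Some u) None (interleaving A v w) \<in> L}"
      using h_interleaving[OF _ nv] by auto
    ultimately show "{u \<in> A. h u v w \<in> L} \<in> (\<lambda>s. {u \<in> A. h (Some u) None s \<in> L}) ` I" by blast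
  qed
  then have "card ((\<lambda>v. {u \<in> A. h u v w \<in> L}) ` B) \<le> card I"
    using finI by (meson card_image_le card_mono finite_imageI le_trans)
  also have "\<dots> \<le> (\<Sum>j\<le>k. card (shuffles a (replicate j None)))"
    unfolding I_def by (rule card_UN_le) simp
  also have "\<dots> \<le> (\<Sum>j\<le>k. (card A * k + k) ^ k)"
    by (rule sum_mono) (use card_shuffles in auto)
  finally show ?thesis by simp
qed

text \<open>For \<open>m = q * Suc k\<close>, the left side is at most \<open>D * Suc q ^ k\<close>,
  while \<open>2 ^ m\<close> is at least \<open>Suc q ^ Suc k\<close>. Taking
  \<open>q = Suc D\<close> turns the extra factor \<open>Suc q\<close> into \<open>D + 2\<close>,
  and the surplus absorbs the subtracted 1.\<close>

lemma ex_polynomial_less_exponential: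
  "\<exists>m. Suc k * (m * k + k) ^ k < 2 ^ m - (1::nat)"
proof -
  define D where "D = Suc k * (k * Suc k) ^ k"
  define q where "q = Suc D"
  define m where "m = q * Suc k"
  have "m * k + k \<le> k * Suc k * Suc q"
    by (simp add: m_def algebra_simps)
  then have "Suc k * (m * k + k) ^ k \<le> Suc k * (k * Suc k * Suc q) ^ k"
    by (intro mult_le_mono power_mono) auto
  also have "\<dots> = D * Suc q ^ k"
    by (simp only: D_def power_mult_distrib mult.assoc)
  finally have "Suc k * (m * k + k) ^ k \<le> D * Suc q ^ k" .
  moreover have "1 \<le> Suc q ^ k" by simp
  moreover have "Suc (Suc D) * Suc q ^ k = D * Suc q ^ k + 2 * Suc q ^ k"
    by (simp only: mult_Suc)
  ultimately have "Suc k * (m * k + k) ^ k + 1 < Suc (Suc D) * Suc q ^ k"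
    by linarith
  also have "\<dots> = Suc q ^ Suc k" by (simp add: q_def)
  also have "\<dots> \<le> (2 ^ q) ^ Suc k"
    by (intro power_mono) (auto simp: Suc_le_eq)
  also have "\<dots> = 2 ^ m" by (simp only: m_def power_mult)
  finally show ?thesis by (intro exI[of _ m]) linarith
qed

text \<open>This is the bipartite incidence graph of points and nonempty sets. Without the empty
  set, no vertex is isolated.\<close>

definition subset_graph :: "nat \<Rightarrow> (nat + nat set) ugraph" where
  "subset_graph m =
     \<lparr>verts = Inl ` {..<m} \<union> Inr ` (Pow {..<m} - {{}}),
      edges = {{Inl i, Inr S} | i S. i \<in> S \<and> S \<subseteq> {..<m}}\<rparr>"

lemma simple_graph_subset_graph:
  assumes "0 < m"
  shows "simple_graph (subset_graph m)"
  using assms by (auto simp: simple_graph_def subset_graph_def)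

lemma adjacent_subset_graph_iff:
  assumes "S \<subseteq> {..<m}"
  shows "{Inl i, Inr S} \<in> edges (subset_graph m) \<longleftrightarrow> i \<in> S"
  using assms by (auto simp: subset_graph_def doubleton_eq_iff)

lemma subset_graph_not_isomorphic_word_graph:
  assumes "symmetric01 L" "\<And>x. x \<in> L \<Longrightarrow> length x \<le> k"
    and large: "Suc k * (m * k + k) ^ k < 2 ^ m - 1"
  shows "\<not> isomorphic (subset_graph m) (word_graph L w)"
proof
  assume "isomorphic (subset_graph m) (word_graph L w)"
  then obtain f where bij: "bij_betw f (verts (subset_graph m)) (set w)"
    and edge: "\<And>u v. u \<in> verts (subset_graph m) \<Longrightarrow> v \<in> verts (subset_graph m) \<Longrightarrow>
      {u, v} \<in> edges (subset_graph m) \<longleftrightarrow> {f u, f v} \<in> edges (word_graph L w)"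
    unfolding isomorphic_def by (auto simp: word_graph_def)
  let ?P = "Pow {..<m} - {{}}"
  have inj: "inj_on f (verts (subset_graph m))" using bij by (simp add: bij_betw_def)
  have verts: "Inl i \<in> verts (subset_graph m) \<longleftrightarrow> i < m"
    "Inr S \<in> verts (subset_graph m) \<longleftrightarrow> S \<in> ?P" for i S
    by (auto simp: subset_graph_def)
  have neq: "f (Inl i) \<noteq> f (Inr S)" if "i < m" "S \<in> ?P" for i S
    using inj_on_eq_iff[OF inj, of "Inl i" "Inr S"] that verts by simp
  have adj: "h (f (Inl i)) (f (Inr S)) w \<in> L \<longleftrightarrow> i \<in> S" if "i < m" "S \<in> ?P" for i S
  proof -
    have "f (Inl i) \<in> set w" "f (Inr S) \<in> set w"
      using that verts bij_betwE[OF bij] by blast+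
    then show ?thesis
      using adjacent_word_graph_iff[OF assms(1) _ _ neq[OF that]] edge[of "Inl i" "Inr S"]
        adjacent_subset_graph_iff[of S m i] that verts by auto
  qed
  let ?A = "(\<lambda>i. f (Inl i)) ` {..<m}" and ?B = "(\<lambda>S. f (Inr S)) ` ?P"
  let ?N = "\<lambda>v. {u \<in> ?A. h u v w \<in> L}"
  have injA: "inj_on (\<lambda>i. f (Inl i)) {..<m}"
    using inj verts by (auto simp: inj_on_def)
  have cardA: "card ?A = m" using card_image[OF injA] by simp
  have occurrences: "count_list w (f (Inl i)) \<le> k" "count_list w (f (Inr S)) \<le> k"
    if "i \<in> S" "S \<in> ?P" for i S
  proof -
    have i: "i < m" using that by auto
    then have "length (h (f (Inl i)) (f (Inr S)) w) \<le> k"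
      using adj[OF i that(2)] that(1) assms(2) by blast
    then show "count_list w (f (Inl i)) \<le> k" "count_list w (f (Inr S)) \<le> k"
      using count_list_le_length_h[OF neq[OF i that(2)], of w] by simp_all
  qed
  have count: "count_list w u \<le> k" if "u \<in> ?A \<union> ?B" for u
  proof -
    from that show ?thesis
    proof (elim UnE imageE)
      fix i assume "u = f (Inl i)" "i \<in> {..<m}"
      \<comment> \<open>The singleton provides a neighbour of the point \<open>i\<close>.\<close>
      then show ?thesis using occurrences(1)[of i "{i}"] by simp
    next
      fix S assume S: "u = f (Inr S)" "S \<in> ?P"
      then obtain i where "i \<in> S" by auto
      then show ?thesis using S occurrences(2)[of i S] by simp
    qed
  qed
  have "?N (f (Inr S)) = (\<lambda>i. f (Inl i)) ` S" if "S \<in> ?P" for S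
    using adj[OF _ that] that by auto
  then have "?N ` ?B = (`) (\<lambda>i. f (Inl i)) ` ?P"
    by (simp only: image_image cong: image_cong)
  \<comment> \<open>Distinct sets therefore have distinct neighbourhoods within
    \<open>?A\<close>.\<close>
  moreover have "inj_on ((`) (\<lambda>i. f (Inl i))) ?P"
    using inj_on_image_Pow[OF injA] by (rule inj_on_subset) auto
  ultimately have "card (?N ` ?B) = card ?P" by (simp only: card_image)
  also have "\<dots> = 2 ^ m - 1" by (simp add: card_Diff_subset card_Pow)
  finally have "card (?N ` ?B) = 2 ^ m - 1" .
  moreover have "card (?N ` ?B) \<le> Suc k * (card ?A * k + k) ^ k"
    by (rule card_neighbourhoods_le) (use neq count in auto)
  ultimately show False using large cardA by simp
qed

theorem mainTheorem4:
  fixes L :: "bin_word set"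
  assumes "finite L" and "symmetric01 L"
  shows "\<not> all_graphs \<subseteq> graph_class L"
proof
  assume all: "all_graphs \<subseteq> graph_class L"
  \<comment> \<open>Unlike a maximum, the sum also makes sense for empty \<open>L\<close>.\<close>
  define k where "k = (\<Sum>x\<in>L. length x)"
  have k: "length x \<le> k" if "x \<in> L" for x
    unfolding k_def using member_le_sum[of x L length] that assms(1) by simp
  obtain m where m: "Suc k * (m * k + k) ^ k < 2 ^ m - (1::nat)"
    using ex_polynomial_less_exponential by blast
  \<comment> \<open>For \<open>m = 0\<close> the right side would be 0; positivity makes the vertex
    set of \<open>subset_graph m\<close> nonempty.\<close>
  then have "0 < m" by (cases m) auto
  then obtain H where H: "H \<in> all_graphs" "isomorphic (subset_graph m) H"
    using ex_isomorphic_nat_graph simple_graph_subset_graph by blast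
  then obtain w :: "nat list" where "isomorphic H (word_graph L w)"
    using all unfolding graph_class_def representable_def by blast
  then have "isomorphic (subset_graph m) (word_graph L w)"
    using isomorphic_trans[OF H(2)] by blast
  then show False
    using subset_graph_not_isomorphic_word_graph[OF assms(2) k m] by blast
qed

end
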